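(* Let $D$ be a non-commutative division ring with center $F$ and let $M$ be an irreducible metabelian locally solvable maximal subgroup of $D^*$. If there exists an element $\alpha\in M\setminus F$ that is algebraic over $F$, then $[D:F]<\infty$.
   Context: $D^*$ is the multiplicative group of $D$; maximal subgroup = proper subgroup maximal among proper subgroups. A subgroup $G\le D^*$ is irreducible if the division subring $F(G)$ generated by $F\cup G$ equals $D$. Locally solvable: every finitely generated subgroup solvable. Metabelian: the derived subgroup is abelian. *)

theory Defs
  imports "HOL-Algebra.Solvable_Groups"
begin

definition units_grp :: "'a::division_ring monoid" where
  "units_grp = \<lparr>carrier = UNIV - {0}, mult = (*), one = 1\<rparr>"

definition center :: "'a::ring set" where
  "center = {z. \<forall>x. z * x = x * z}"

definition division_subring :: "'a::division_ring set \<Rightarrow> bool" where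
  "division_subring S \<longleftrightarrow> 0 \<in> S \<and> 1 \<in> S \<and>
     (\<forall>x\<in>S. \<forall>y\<in>S. x + y \<in> S \<and> x * y \<in> S) \<and>
     (\<forall>x\<in>S. - x \<in> S) \<and> (\<forall>x\<in>S. x \<noteq> 0 \<longrightarrow> inverse x \<in> S)"

definition div_subring_gen :: "'a::division_ring set \<Rightarrow> 'a set" where
  "div_subring_gen X = \<Inter>{S. division_subring S \<and> X \<subseteq> S}"

definition maximal_subgroup :: "'a::division_ring set \<Rightarrow> bool" where
  "maximal_subgroup M \<longleftrightarrow> subgroup M units_grp \<and> M \<noteq> carrier units_grp \<and>
     (\<forall>H. subgroup H units_grp \<and> M \<subseteq> H \<longrightarrow> H = M \<or> H = carrier units_grp)"

definition irreducible_subgroup :: "'a::division_ring set \<Rightarrow> bool" where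
  "irreducible_subgroup M \<longleftrightarrow> div_subring_gen (center \<union> M) = UNIV"

definition locally_solvable :: "'a::division_ring set \<Rightarrow> bool" where
  "locally_solvable M \<longleftrightarrow>
     (\<forall>S. finite S \<and> S \<subseteq> M \<longrightarrow> solvable (subgroup_generated units_grp S))"

definition metabelian :: "'a::division_ring set \<Rightarrow> bool" where
  "metabelian M \<longleftrightarrow> (\<forall>x\<in>derived units_grp M. \<forall>y\<in>derived units_grp M. x * y = y * x)"

definition algebraic_over_center :: "'a::division_ring \<Rightarrow> bool" where
  "algebraic_over_center a \<longleftrightarrow> (\<exists>n c. (\<forall>i\<le>n. c i \<in> center) \<and> (\<exists>i\<le>n. c i \<noteq> 0) \<and>
      (\<Sum>i\<le>n. c i * a ^ i) = 0)"

definition finite_dim_over_center :: "'a::division_ring itself \<Rightarrow> bool" where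
  "finite_dim_over_center _ \<longleftrightarrow> (\<exists>B::'a set. finite B \<and>
     (\<forall>x. \<exists>c. (\<forall>b\<in>B. c b \<in> center) \<and> x = (\<Sum>b\<in>B. c b * b)))"

end

theory Submission
  imports Defs
begin

text \<open>
  If a division subring \<open>C\<close> of \<open>D\<close> is normalized by \<open>M\<close>, then maximality together with the
  Cartan--Brauer--Hua theorem leaves only \<open>C\<^sup>* \<subseteq> M\<close>, \<open>C = D\<close> or \<open>C \<subseteq> F\<close>, and in the first case
  \<open>C\<close> is commutative because \<open>M\<close> is metabelian. Applied to the division subring generated by \<open>F\<close>
  and a maximal commuting subset of \<open>M\<close> containing \<open>M'\<close>, this yields a field \<open>K\<close> with
  \<open>F \<subseteq> K\<close>, \<open>K\<^sup>* \<unlhd> M\<close>, \<open>C\<^sub>M(K) = K\<^sup>*\<close> and \<open>M / K\<^sup>*\<close> abelian.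

  If \<open>\<alpha> \<in> K\<close>, the conjugates of \<open>\<alpha>\<close> under \<open>M\<close> are finitely many, and applying the trichotomy to
  their centralizer shows that this centralizer is \<open>K\<close>; hence \<open>M / K\<^sup>*\<close> is finite.
  If \<open>\<alpha> \<notin> K\<close>, linear independence of distinct cosets of \<open>K\<^sup>*\<close> forces \<open>\<alpha>\<^sup>m \<in> K\<close> for some \<open>m > 0\<close>,
  and the trichotomy applied to the division subring generated by \<open>K\<close> and \<open>\<alpha>\<close> shows that it is \<open>D\<close>.
  In both cases \<open>D\<close> is spanned over \<open>K\<close> by finitely many elements representing a finite group of
  automorphisms of \<open>K\<close> with fixed field \<open>F\<close>, so that \<open>[K:F]\<close> and \<open>[D:K]\<close> are finite.
\<close>

section \<open>Conjugation, centralizers and generated division subrings\<close>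

definition centralizer :: "'a::ring set \<Rightarrow> 'a set" where
  "centralizer S = {x. \<forall>s\<in>S. x * s = s * x}"

definition conjg :: "'a::division_ring \<Rightarrow> 'a \<Rightarrow> 'a" where
  "conjg u x = u * x * inverse u"

text \<open>Coefficients act from the left. For infinite \<open>B\<close> every such sum is 0 by
  convention, so the notion is meaningful for finite \<open>B\<close>.\<close>

definition lspan :: "'a::ring set \<Rightarrow> 'a set \<Rightarrow> 'a set" where
  "lspan K B = {x. \<exists>c. (\<forall>b\<in>B. c b \<in> K) \<and> x = (\<Sum>b\<in>B. c b * b)}"

lemma conjg_add: "conjg u (x + y) = conjg u x + conjg u y"
  and conjg_minus: "conjg u (- x) = - conjg u x"
  and conjg_zero: "conjg u 0 = 0"
  and conjg_one_left: "conjg 1 x = x"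
  by (simp_all add: conjg_def algebra_simps)

lemma conjg_sum: "conjg u (\<Sum>i\<in>I. f i) = (\<Sum>i\<in>I. conjg u (f i))"
  by (simp add: conjg_def sum_distrib_left sum_distrib_right)

lemma conjg_one: "u \<noteq> 0 \<Longrightarrow> conjg u 1 = 1"
  by (simp add: conjg_def)

lemma conjg_mult: "u \<noteq> 0 \<Longrightarrow> conjg u (x * y) = conjg u x * conjg u y"
  by (simp add: conjg_def mult.assoc flip: mult.assoc[of "inverse u" u])

lemma conjg_mult_left: "u \<noteq> 0 \<Longrightarrow> v \<noteq> 0 \<Longrightarrow> conjg (u * v) x = conjg u (conjg v x)"
  by (simp add: conjg_def nonzero_inverse_mult_distrib mult.assoc)

lemma conjg_inverse: "u \<noteq> 0 \<Longrightarrow> conjg u (inverse x) = inverse (conjg u x)"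
  by (cases "x = 0") (simp_all add: conjg_def nonzero_inverse_mult_distrib mult.assoc)

lemma conjg_eq_0_iff: "u \<noteq> 0 \<Longrightarrow> conjg u x = 0 \<longleftrightarrow> x = 0"
  by (simp add: conjg_def)

lemma conjg_inverse_left: "u \<noteq> 0 \<Longrightarrow> conjg (inverse u) (conjg u x) = x"
  by (metis conjg_mult_left conjg_one_left left_inverse nonzero_imp_inverse_nonzero)

lemma conjg_eq_iff: "u \<noteq> 0 \<Longrightarrow> conjg u x = y \<longleftrightarrow> u * x = y * u"
  by (metis conjg_def mult.assoc left_inverse mult.right_neutral right_inverse)

lemma conjg_mult_right: "u \<noteq> 0 \<Longrightarrow> conjg u x * u = u * x"
  by (simp add: conjg_def mult.assoc)

lemma conjg_power: "u \<noteq> 0 \<Longrightarrow> conjg u (x ^ n) = conjg u x ^ n"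
  by (induction n) (simp_all add: conjg_one conjg_mult)

lemma division_subringD:
  assumes "division_subring S"
  shows "0 \<in> S" "1 \<in> S" "x \<in> S \<Longrightarrow> y \<in> S \<Longrightarrow> x + y \<in> S" "x \<in> S \<Longrightarrow> y \<in> S \<Longrightarrow> x * y \<in> S"
    "x \<in> S \<Longrightarrow> - x \<in> S" "x \<in> S \<Longrightarrow> inverse x \<in> S" "x \<in> S \<Longrightarrow> y \<in> S \<Longrightarrow> x - y \<in> S"
proof -
  show *: "0 \<in> S" "1 \<in> S" "x \<in> S \<Longrightarrow> y \<in> S \<Longrightarrow> x + y \<in> S" "x \<in> S \<Longrightarrow> y \<in> S \<Longrightarrow> x * y \<in> S"
    "x \<in> S \<Longrightarrow> - x \<in> S" for x y
    using assms by (auto simp: division_subring_def)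
  show "x \<in> S \<Longrightarrow> inverse x \<in> S"
    using assms by (cases "x = 0") (auto simp: division_subring_def)
  show "x \<in> S \<Longrightarrow> y \<in> S \<Longrightarrow> x - y \<in> S"
    using *(3)[of x "- y"] *(5)[of y] by simp
qed

lemma division_subring_sum:
  "division_subring S \<Longrightarrow> (\<And>i. i \<in> I \<Longrightarrow> f i \<in> S) \<Longrightarrow> (\<Sum>i\<in>I. f i) \<in> S"
  by (induction I rule: infinite_finite_induct) (auto intro: division_subringD)

lemma division_subring_power:
  "division_subring S \<Longrightarrow> x \<in> S \<Longrightarrow> x ^ n \<in> S"
  by (induction n) (auto intro: division_subringD)

lemma division_subring_UNIV: "division_subring UNIV"
  by (simp add: division_subring_def)

lemma centralizerD: "x \<in> centralizer S \<Longrightarrow> s \<in> S \<Longrightarrow> x * s = s * x"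
  by (simp add: centralizer_def)

lemma division_subring_centralizer: "division_subring (centralizer (S :: 'a::division_ring set))"
proof -
  have "inverse x * s = s * inverse x" if "x * s = s * x" for x s :: 'a
  proof (cases "x = 0")
    case False
    have "inverse x * (x * s) * inverse x = inverse x * (s * x) * inverse x"
      using that by simp
    then have "inverse x * x * s * inverse x = inverse x * s * (x * inverse x)"
      by (simp only: mult.assoc)
    then show ?thesis
      using False by simp
  qed auto
  moreover have "x * y * s = s * (x * y)" if "x * s = s * x" "y * s = s * y" for x y s :: 'a
    using that by (metis mult.assoc)
  ultimately show ?thesis
    unfolding division_subring_def centralizer_def
    by (simp add: distrib_left distrib_right)
qed

lemma division_subring_gen: "division_subring (div_subring_gen X)"
  by (auto simp: div_subring_gen_def division_subring_def)

lemma subset_div_subring_gen: "X \<subseteq> div_subring_gen X"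
  by (auto simp: div_subring_gen_def)

lemma div_subring_gen_least: "division_subring S \<Longrightarrow> X \<subseteq> S \<Longrightarrow> div_subring_gen X \<subseteq> S"
  by (auto simp: div_subring_gen_def)

text \<open>Two passes through the centralizer: the generators centralize each other, so everything
  generated centralizes \<open>X\<close>; hence \<open>X\<close> centralizes everything generated,
  and so does the division subring it generates.\<close>

lemma div_subring_gen_commute:
  assumes "\<And>x y. x \<in> X \<Longrightarrow> y \<in> X \<Longrightarrow> x * y = y * x"
    and "x \<in> div_subring_gen X" "y \<in> div_subring_gen X"
  shows "x * y = y * x"
proof -
  have "div_subring_gen X \<subseteq> centralizer X"
    using assms(1) by (intro div_subring_gen_least division_subring_centralizer)
      (auto simp: centralizer_def)
  then have "X \<subseteq> centralizer (div_subring_gen X)"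
    by (force simp: centralizer_def)
  then have "div_subring_gen X \<subseteq> centralizer (div_subring_gen X)"
    by (intro div_subring_gen_least division_subring_centralizer)
  then show ?thesis
    using assms(2,3) by (auto simp: centralizer_def)
qed

text \<open>The preimage of a division subring under the automorphism \<open>conjg u\<close> is a
  division subring, so it suffices to check generators.\<close>

lemma div_subring_gen_conjg:
  assumes "u \<noteq> 0" and "\<And>x. x \<in> X \<Longrightarrow> conjg u x \<in> div_subring_gen X"
    and "x \<in> div_subring_gen X"
  shows "conjg u x \<in> div_subring_gen X"
proof -
  have "division_subring {x. conjg u x \<in> div_subring_gen X}"
    using division_subringD[OF division_subring_gen[of X]] \<open>u \<noteq> 0\<close>
    by (auto simp: division_subring_def conjg_add conjg_minus conjg_zero conjg_one conjg_mult
        conjg_inverse)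
  from div_subring_gen_least[OF this] show ?thesis
    using assms(2,3) by auto
qed

section \<open>The Cartan-Brauer-Hua theorem and metabelian unit groups\<close>

text \<open>For \<open>x\<close> outside \<open>K\<close> and \<open>a\<close> in \<open>K\<close>,
  comparing conjugation by \<open>x\<close> and by \<open>1 + x\<close> gives a linear equation for
  \<open>x\<close> over \<open>K\<close>. It would put \<open>x\<close> into \<open>K\<close> unless
  both conjugates agree, and then both equal \<open>a\<close>.\<close>

theorem Cartan_Brauer_Hua:
  assumes C: "division_subring C" and K: "division_subring K" and "K \<subseteq> C"
    and norm: "\<And>c x. c \<in> C \<Longrightarrow> c \<noteq> 0 \<Longrightarrow> x \<in> K \<Longrightarrow> conjg c x \<in> K"
  shows "K = C \<or> K \<subseteq> centralizer C"
proof (cases "K = C")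
  case False
  then obtain x0 where x0: "x0 \<in> C" "x0 \<notin> K"
    using \<open>K \<subseteq> C\<close> by auto
  have *: "x * a = a * x" if x: "x \<in> C" "x \<notin> K" and a: "a \<in> K" for x a
  proof -
    have nz: "x \<noteq> 0" "1 + x \<noteq> 0"
      using x division_subringD[OF K] by (auto simp: add_eq_0_iff)
    define a1 a2 where "a1 = conjg x a" and "a2 = conjg (1 + x) a"
    have a12: "a1 \<in> K" "a2 \<in> K"
      using norm a x nz division_subringD[OF C] by (auto simp: a1_def a2_def)
    have e1: "a1 * x = x * a" and e2: "a2 * (1 + x) = (1 + x) * a"
      using nz by (simp_all add: a1_def a2_def conjg_mult_right)
    have e: "a2 - a = (a1 - a2) * x"
      using e1 e2 by (simp add: algebra_simps)
    have "a1 = a2"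
    proof (rule ccontr)
      assume "a1 \<noteq> a2"
      then have "x = inverse (a1 - a2) * (a2 - a)"
        by (simp add: e flip: mult.assoc)
      also have "\<dots> \<in> K"
        using a a12 by (intro division_subringD[OF K])
      finally show False
        using x by simp
    qed
    with e e1 show ?thesis by simp
  qed
  have "K \<subseteq> centralizer C"
  proof
    fix a assume a: "a \<in> K"
    have "y * a = a * y" if "y \<in> C" for y
    proof (cases "y \<in> K")
      case True
      \<comment> \<open>An element \<open>y\<close> of \<open>K\<close> is the difference of
        \<open>x0 + y\<close> and \<open>x0\<close>, both outside \<open>K\<close> and hence both
        commuting with \<open>a\<close>.\<close>
      have "x0 + y \<notin> K"
      proof
        assume "x0 + y \<in> K"
        then have "x0 + y - y \<in> K"
          using True by (rule division_subringD[OF K])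
        then show False using x0 by simp
      qed
      then have "(x0 + y) * a = a * (x0 + y)"
        using x0 that a by (intro * division_subringD[OF C])
      then show ?thesis
        using *[OF x0 a] by (simp add: algebra_simps)
    qed (use * that a in auto)
    then show "a \<in> centralizer C"
      by (simp add: centralizer_def)
  qed
  then show ?thesis ..
qed auto

text \<open>The commutators generate a commutative division subring normalized by all units of
  \<open>C\<close>. By Cartan-Brauer-Hua it is \<open>C\<close> itself or central in
  \<open>C\<close>; the second case is excluded for non-commuting \<open>x\<close>, \<open>y\<close>
  by comparing the commutators of \<open>x\<close> with \<open>y\<close> and with
  \<open>y + 1\<close>.\<close>

lemma metabelian_division_subring_commute:
  assumes C: "division_subring C"
    and meta: "\<And>a b c d. a \<in> C \<Longrightarrow> b \<in> C \<Longrightarrow> c \<in> C \<Longrightarrow> d \<in> C \<Longrightarrow> a \<noteq> 0 \<Longrightarrow> b \<noteq> 0 \<Longrightarrow> c \<noteq> 0 \<Longrightarrow> d \<noteq> 0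
      \<Longrightarrow> conjg a b * inverse b * (conjg c d * inverse d) = conjg c d * inverse d * (conjg a b * inverse b)"
    and "x \<in> C" "y \<in> C"
  shows "x * y = y * x"
proof -
  define X where "X = {conjg a b * inverse b |a b. a \<in> C - {0} \<and> b \<in> C - {0}}"
  define P where "P = div_subring_gen X"
  have XC: "X \<subseteq> C"
    using division_subringD[OF C] by (auto simp: X_def conjg_def)
  have P: "division_subring P" "P \<subseteq> C" "X \<subseteq> P"
    using div_subring_gen_least[OF C XC] subset_div_subring_gen[of X]
    by (simp_all add: P_def division_subring_gen)
  have P_comm: "p * q = q * p" if "p \<in> P" "q \<in> P" for p q
    using that unfolding P_def
    by (rule div_subring_gen_commute[rotated]) (auto simp: X_def intro!: meta)
  have norm: "conjg c p \<in> P" if c: "c \<in> C" "c \<noteq> 0" and p: "p \<in> P" for c p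
  proof -
    have "conjg c q \<in> P" if q: "q \<in> X" for q
    proof -
      obtain a b where ab: "a \<in> C - {0}" "b \<in> C - {0}" "q = conjg a b * inverse b"
        using q unfolding X_def by blast
      have "conjg c q = conjg (conjg c a) (conjg c b) * inverse (conjg c b)"
        using c ab by (simp add: conjg_mult conjg_inverse) (simp add: conjg_def[of a] conjg_mult conjg_inverse conjg_def[of "conjg c a"])
      moreover have "conjg c a \<in> C - {0}" "conjg c b \<in> C - {0}"
        using ab c division_subringD[OF C] by (auto simp: conjg_eq_0_iff) (auto simp: conjg_def)
      ultimately have "conjg c q \<in> X"
        by (auto simp: X_def)
      then show ?thesis using P by auto
    qed
    then show ?thesis
      using div_subring_gen_conjg[of c X p] c p unfolding P_def by blast
  qed
  from Cartan_Brauer_Hua[OF C P(1,2) norm] consider "P = C" | "P \<subseteq> centralizer C"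
    by blast
  then show ?thesis
  proof cases
    case 1
    then show ?thesis using P_comm assms(3,4) by auto
  next
    case 2
    show ?thesis
    proof (rule ccontr)
      assume neq: "x * y \<noteq> y * x"
      then have nz: "x \<noteq> 0" "y \<noteq> 0" "y + 1 \<noteq> 0"
        by (auto simp: add_eq_0_iff2)
      define z z' where "z = conjg x y * inverse y" and "z' = conjg x (y + 1) * inverse (y + 1)"
      have "z \<in> X" "z' \<in> X"
        using nz assms(3,4) division_subringD[OF C] by (auto simp: X_def z_def z'_def)
      then have zc: "z \<in> centralizer C" "z' \<in> centralizer C"
        using 2 P by auto
      have "conjg x y = z * y" "conjg x (y + 1) = z' * (y + 1)"
        using nz by (simp_all add: z_def z'_def mult.assoc)
      then have "z * y + 1 = z' * (y + 1)"
        using nz by (simp add: conjg_add conjg_one)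
      \<comment> \<open>Unless \<open>z = z'\<close>, this equation expresses \<open>y\<close>
        through elements central in \<open>C\<close>. If \<open>z = z'\<close>, it gives
        \<open>z = 1\<close>, so \<open>x\<close> and \<open>y\<close> commute in either
        case.\<close>
      then have e: "(z - z') * y = z' - 1"
        by (simp add: algebra_simps)
      note Z = division_subringD[OF division_subring_centralizer[of C]]
      have "z = z'"
      proof (rule ccontr)
        assume "z \<noteq> z'"
        then have "y = inverse (z - z') * (z' - 1)"
          by (simp flip: e mult.assoc)
        also have "\<dots> \<in> centralizer C"
          using zc by (intro Z)
        finally show False
          using neq assms(3) by (auto simp: centralizer_def)
      qed
      with e have "z = 1" by simp
      then have "conjg x y = y"
        using \<open>conjg x y = z * y\<close> by simp
      then show False
        using neq nz by (simp add: conjg_eq_iff)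
    qed
  qed
qed

section \<open>The unit group and its maximal subgroups\<close>

lemma group_units_grp: "group (units_grp :: 'a::division_ring monoid)"
proof (rule groupI)
  fix x :: 'a assume "x \<in> carrier units_grp"
  then show "\<exists>y\<in>carrier units_grp. y \<otimes>\<^bsub>units_grp\<^esub> x = \<one>\<^bsub>units_grp\<^esub>"
    by (intro bexI[of _ "inverse x"]) (auto simp: units_grp_def)
qed (auto simp: units_grp_def mult.assoc)

lemma inv_units_grp:
  assumes "(x :: 'a::division_ring) \<noteq> 0" shows "inv\<^bsub>units_grp\<^esub> x = inverse x"
  using assms by (intro group.inv_equality[OF group_units_grp]) (auto simp: units_grp_def)

lemma subgroup_units_grp_iff:
  "subgroup H units_grp \<longleftrightarrow>
    0 \<notin> H \<and> 1 \<in> H \<and> (\<forall>x\<in>H. \<forall>y\<in>H. x * y \<in> H) \<and> (\<forall>x\<in>H. inverse x \<in> H)" (is "_ \<longleftrightarrow> ?R")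
proof
  assume H: "subgroup H units_grp"
  then have "0 \<notin> H"
    using subgroup.subset by (force simp: units_grp_def)
  moreover have "inverse x \<in> H" if "x \<in> H" for x
    using subgroup.m_inv_closed[OF H that] inv_units_grp[of x] that \<open>0 \<notin> H\<close> by metis
  ultimately show ?R
    using subgroup.m_closed[OF H] subgroup.one_closed[OF H] by (auto simp: units_grp_def)
next
  assume ?R
  then have "inv\<^bsub>units_grp\<^esub> x = inverse x" if "x \<in> H" for x
    using that by (intro inv_units_grp) auto
  with \<open>?R\<close> show "subgroup H units_grp"
    by (unfold_locales) (auto simp: units_grp_def)
qed

text \<open>The element is the commutator of \<open>a\<close> and \<open>b\<close> written with
  \<open>conjg\<close>; in this form the metabelian hypothesis enters the later arguments.\<close>

lemma commutator_in_derived: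
  assumes "0 \<notin> M" "a \<in> M" "b \<in> M"
  shows "conjg a b * inverse b \<in> derived units_grp M"
proof -
  have "conjg a b * inverse b =
      a \<otimes>\<^bsub>units_grp\<^esub> b \<otimes>\<^bsub>units_grp\<^esub> inv\<^bsub>units_grp\<^esub> a \<otimes>\<^bsub>units_grp\<^esub> inv\<^bsub>units_grp\<^esub> b"
  proof -
    have "inv\<^bsub>units_grp\<^esub> a = inverse a" "inv\<^bsub>units_grp\<^esub> b = inverse b"
      using assms by (metis inv_units_grp)+
    then show ?thesis
      by (simp only:) (simp add: units_grp_def conjg_def)
  qed
  also have "\<dots> \<in> derived units_grp M"
    unfolding derived_def using assms by (intro generate.incl) blast
  finally show ?thesis .
qed

text \<open>Since \<open>M\<close> normalizes \<open>C\<close>, the products of elements of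
  \<open>M\<close> and units of \<open>C\<close> form a subgroup \<open>H\<close> above
  \<open>M\<close>. Maximality gives \<open>H = M\<close>, so the units of \<open>C\<close> lie in
  \<open>M\<close>, or \<open>H\<close> is the whole unit group, so every unit normalizes
  \<open>C\<close> and Cartan-Brauer-Hua applies.\<close>

lemma maximal_subgroup_normalizes_division_subring:
  assumes M: "maximal_subgroup M" and C: "division_subring C"
    and norm: "\<And>m c. m \<in> M \<Longrightarrow> c \<in> C \<Longrightarrow> conjg m c \<in> C"
  shows "C - {0} \<subseteq> M \<or> C = UNIV \<or> C \<subseteq> center"
proof -
  have M': "0 \<notin> M" "1 \<in> M" "\<And>x y. x \<in> M \<Longrightarrow> y \<in> M \<Longrightarrow> x * y \<in> M" "\<And>x. x \<in> M \<Longrightarrow> inverse x \<in> M"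
    using M by (auto simp: maximal_subgroup_def subgroup_units_grp_iff)
  note C' = division_subringD[OF C]
  define H where "H = {m * c |m c. m \<in> M \<and> c \<in> C - {0}}"
  have HI: "m * c \<in> H" if "m \<in> M" "c \<in> C" "c \<noteq> 0" for m c
    using that by (auto simp: H_def)
  have "subgroup H units_grp"
    unfolding subgroup_units_grp_iff
  proof (intro conjI ballI)
    show "0 \<notin> H"
      using M' by (auto simp: H_def)
    show "1 \<in> H"
      using HI[of 1 1] M' C' by auto
  next
    fix x y assume "x \<in> H" "y \<in> H"
    then obtain m c n d where *: "m \<in> M" "c \<in> C" "c \<noteq> 0" "n \<in> M" "d \<in> C" "d \<noteq> 0" "x = m * c" "y = n * d"
      by (auto simp: H_def)
    then have "n \<noteq> 0" using M' by auto
    then have "x * y = (m * n) * (conjg (inverse n) c * d)"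
      using * by (simp add: conjg_def mult.assoc) (simp flip: mult.assoc)
    also have "\<dots> \<in> H"
      using * \<open>n \<noteq> 0\<close> by (intro HI M' C' norm) (auto simp: conjg_eq_0_iff)
    finally show "x * y \<in> H" .
  next
    fix x assume "x \<in> H"
    then obtain m c where *: "m \<in> M" "c \<in> C" "c \<noteq> 0" "x = m * c"
      by (auto simp: H_def)
    then have "m \<noteq> 0" using M' by auto
    then have "inverse x = inverse m * conjg m (inverse c)"
      using * by (simp add: conjg_def nonzero_inverse_mult_distrib) (simp flip: mult.assoc)
    also have "\<dots> \<in> H"
      using * \<open>m \<noteq> 0\<close> by (intro HI M' C' norm) (auto simp: conjg_eq_0_iff)
    finally show "inverse x \<in> H" .
  qed
  moreover have "M \<subseteq> H"
    using HI[of _ 1] C' by auto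
  ultimately consider "H = M" | "H = carrier units_grp"
    using M by (auto simp: maximal_subgroup_def)
  then show ?thesis
  proof cases
    case 1
    then show ?thesis
      using HI[of 1] M' by auto
  next
    case 2
    have "conjg x c \<in> C" if "x \<noteq> 0" "c \<in> C" for x c
    proof -
      obtain m d where *: "m \<in> M" "d \<in> C" "d \<noteq> 0" "x = m * d"
      proof -
        have "x \<in> H"
          using 2 \<open>x \<noteq> 0\<close> by (simp add: units_grp_def)
        then show thesis
          using that unfolding H_def by blast
      qed
      then have "m \<noteq> 0" using M' by auto
      then have "conjg x c = conjg m (conjg d c)"
        using * by (simp add: conjg_mult_left)
      also have "\<dots> \<in> C"
        using * \<open>c \<in> C\<close> unfolding conjg_def[of d] by (intro norm C') auto
      finally show ?thesis .
    qed
    then have "C = UNIV \<or> C \<subseteq> centralizer UNIV"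
      by (intro Cartan_Brauer_Hua division_subring_UNIV C) auto
    then show ?thesis
      by (auto simp: centralizer_def center_def)
  qed
qed

section \<open>Linear algebra over a division subring\<close>

text \<open>Gaussian elimination, one equation \<open>j0\<close> at a time, with unknowns
  multiplying from the left because \<open>K\<close> need not be commutative.\<close>

lemma homogeneous_system_nontrivial_solution:
  assumes "division_subring K" and "finite J"
    and "finite I" "card J < card I" "\<And>i j. i \<in> I \<Longrightarrow> j \<in> J \<Longrightarrow> c i j \<in> K"
  shows "\<exists>k. (\<forall>i\<in>I. k i \<in> K) \<and> (\<exists>i\<in>I. k i \<noteq> 0) \<and> (\<forall>j\<in>J. (\<Sum>i\<in>I. k i * c i j) = 0)"
  using assms(2-)
proof (induction J arbitrary: I c rule: finite_induct)
  case empty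
  then have "I \<noteq> {}" by auto
  then show ?case
    using division_subringD[OF \<open>division_subring K\<close>] by (intro exI[of _ "\<lambda>_. 1"]) auto
next
  case (insert j0 J)
  note K = division_subringD[OF \<open>division_subring K\<close>]
  show ?case
  proof (cases "\<forall>i\<in>I. c i j0 = 0")
    case True
    have "\<exists>k. (\<forall>i\<in>I. k i \<in> K) \<and> (\<exists>i\<in>I. k i \<noteq> 0) \<and> (\<forall>j\<in>J. (\<Sum>i\<in>I. k i * c i j) = 0)"
      using insert by (intro insert.IH) auto
    then show ?thesis
      using True by auto
  next
    case False
    then obtain i0 where i0: "i0 \<in> I" "c i0 j0 \<noteq> 0" by auto
    define I' where "I' = I - {i0}"
    have I: "I = insert i0 I'" "i0 \<notin> I'" "finite I'"
      using i0 insert.prems by (auto simp: I'_def)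
    \<comment> \<open>Subtracting \<open>r i\<close> times row \<open>i0\<close> from row
      \<open>i\<close> clears the entry in column \<open>j0\<close>.\<close>
    define r where "r i = c i j0 * inverse (c i0 j0)" for i
    have rK: "r i \<in> K" if "i \<in> I" for i
      using that insert.prems i0 by (auto simp: r_def intro!: K)
    have "\<exists>k. (\<forall>i\<in>I'. k i \<in> K) \<and> (\<exists>i\<in>I'. k i \<noteq> 0) \<and>
        (\<forall>j\<in>J. (\<Sum>i\<in>I'. k i * (c i j - r i * c i0 j)) = 0)"
      using insert I i0 by (intro insert.IH) (auto intro!: K rK)
    then obtain k where k: "\<And>i. i \<in> I' \<Longrightarrow> k i \<in> K" "\<exists>i\<in>I'. k i \<noteq> 0"
      "\<And>j. j \<in> J \<Longrightarrow> (\<Sum>i\<in>I'. k i * (c i j - r i * c i0 j)) = 0" by blast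
    \<comment> \<open>The value at \<open>i0\<close> is what turns a solution of the reduced system
      into one of the original system.\<close>
    define k' where "k' = k(i0 := - (\<Sum>i\<in>I'. k i * r i))"
    have "(\<Sum>i\<in>I. k' i * c i j) = (\<Sum>i\<in>I'. k i * (c i j - r i * c i0 j))" for j
    proof -
      have "(\<Sum>i\<in>I'. k' i * c i j) = (\<Sum>i\<in>I'. k i * c i j)"
        using I by (intro sum.cong) (auto simp: k'_def)
      then show ?thesis
        using I by (simp add: algebra_simps sum_subtractf sum_distrib_right) (simp add: k'_def sum_distrib_right mult.assoc)
    qed
    moreover have "(\<Sum>i\<in>I'. k i * (c i j0 - r i * c i0 j0)) = 0"
      using i0 by (simp add: r_def mult.assoc)
    ultimately have "\<forall>j\<in>insert j0 J. (\<Sum>i\<in>I. k' i * c i j) = 0"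
      using k(3) by auto
    moreover have "\<forall>i\<in>I. k' i \<in> K"
      using I k(1) rK \<open>division_subring K\<close> by (auto simp: k'_def intro!: K division_subring_sum)
    moreover have "\<exists>i\<in>I. k' i \<noteq> 0"
      using I k(2) by (auto simp: k'_def)
    ultimately show ?thesis by blast
  qed
qed

lemma lspanI: "(\<And>b. b \<in> B \<Longrightarrow> c b \<in> K) \<Longrightarrow> (\<Sum>b\<in>B. c b * b) \<in> lspan K B"
  by (auto simp: lspan_def)

lemma lspanE:
  assumes "x \<in> lspan K B"
  obtains c where "\<And>b. b \<in> B \<Longrightarrow> c b \<in> K" "x = (\<Sum>b\<in>B. c b * b)"
  using assms by (auto simp: lspan_def)

lemma lspan_zero: "division_subring K \<Longrightarrow> 0 \<in> lspan K B"
  using lspanI[of B "\<lambda>_. 0" K] division_subringD[of K] by auto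

lemma lspan_add:
  assumes K: "division_subring K" and "x \<in> lspan K B" "y \<in> lspan K B"
  shows "x + y \<in> lspan K B"
proof -
  obtain c d where "\<And>b. b \<in> B \<Longrightarrow> c b \<in> K" "x = (\<Sum>b\<in>B. c b * b)"
    "\<And>b. b \<in> B \<Longrightarrow> d b \<in> K" "y = (\<Sum>b\<in>B. d b * b)"
    using assms by (auto elim!: lspanE)
  then show ?thesis
    using lspanI[of B "\<lambda>b. c b + d b" K] division_subringD[OF K]
    by (simp add: sum.distrib algebra_simps)
qed

lemma lspan_scale:
  assumes K: "division_subring K" and "k \<in> K" "x \<in> lspan K B"
  shows "k * x \<in> lspan K B"
proof -
  obtain c where "\<And>b. b \<in> B \<Longrightarrow> c b \<in> K" "x = (\<Sum>b\<in>B. c b * b)"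
    using assms by (auto elim!: lspanE)
  then show ?thesis
    using lspanI[of B "\<lambda>b. k * c b" K] division_subringD[OF K] \<open>k \<in> K\<close>
    by (simp add: sum_distrib_left mult.assoc)
qed

lemma lspan_minus: "division_subring K \<Longrightarrow> x \<in> lspan K B \<Longrightarrow> - x \<in> lspan K B"
  using lspan_scale[of K "-1" x B] division_subringD[of K] by auto

lemma lspan_sum:
  "division_subring K \<Longrightarrow> (\<And>i. i \<in> I \<Longrightarrow> f i \<in> lspan K B) \<Longrightarrow> (\<Sum>i\<in>I. f i) \<in> lspan K B"
  by (induction I rule: infinite_finite_induct) (auto intro: lspan_add lspan_zero)

lemma lspan_base:
  assumes K: "division_subring K" and "finite B" "b \<in> B"
  shows "b \<in> lspan K B"
proof -
  have "(\<Sum>b'\<in>B. (if b' = b then 1 else 0) * b') \<in> lspan K B"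
    using division_subringD[OF K] by (intro lspanI) auto
  also have "(\<Sum>b'\<in>B. (if b' = b then 1 else 0) * b') = (\<Sum>b'\<in>B. if b' = b then b' else 0)"
    by (intro sum.cong) auto
  also have "\<dots> = b"
    using assms by simp
  finally show ?thesis .
qed

text \<open>A domain that is finite-dimensional over a division subring is a division ring:
  the powers of an element satisfy a linear relation, which can be solved for the inverse.\<close>

lemma division_subring_lspan:
  assumes K: "division_subring K" and B: "finite B"
    and one: "1 \<in> lspan K B"
    and mult: "\<And>x y. x \<in> lspan K B \<Longrightarrow> y \<in> lspan K B \<Longrightarrow> x * y \<in> lspan K B"
  shows "division_subring (lspan K B)"
proof -
  have "inverse a \<in> lspan K B" if a: "a \<in> lspan K B" "a \<noteq> 0" for a
  proof -
    have pow: "a ^ i \<in> lspan K B" for i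
      by (induction i) (auto simp: one mult a)
    have "\<exists>c. \<forall>i. (\<forall>b\<in>B. c i b \<in> K) \<and> a ^ i = (\<Sum>b\<in>B. c i b * b)"
      using pow by (intro choice) (auto simp: lspan_def)
    then obtain c where c: "\<And>i b. b \<in> B \<Longrightarrow> c i b \<in> K" "\<And>i. a ^ i = (\<Sum>b\<in>B. c i b * b)"
      by blast
    \<comment> \<open>The powers with exponents \<open>0\<close> to \<open>n\<close> number one more
      than the elements of \<open>B\<close>, which forces a relation.\<close>
    define n where "n = card B"
    have "\<exists>k. (\<forall>i\<in>{..n}. k i \<in> K) \<and> (\<exists>i\<in>{..n}. k i \<noteq> 0) \<and>
        (\<forall>b\<in>B. (\<Sum>i\<in>{..n}. k i * c i b) = 0)"
      using c B by (intro homogeneous_system_nontrivial_solution K) (auto simp: n_def)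
    then obtain k where k: "\<And>i. i \<le> n \<Longrightarrow> k i \<in> K" "\<exists>i\<le>n. k i \<noteq> 0"
      "\<And>b. b \<in> B \<Longrightarrow> (\<Sum>i\<le>n. k i * c i b) = 0"
      by auto
    have rel: "(\<Sum>i\<le>n. k i * a ^ i) = 0"
    proof -
      have "(\<Sum>i\<le>n. k i * a ^ i) = (\<Sum>i\<le>n. \<Sum>b\<in>B. k i * c i b * b)"
        by (simp add: c(2) sum_distrib_left mult.assoc)
      also have "\<dots> = (\<Sum>b\<in>B. (\<Sum>i\<le>n. k i * c i b) * b)"
        by (subst sum.swap) (simp add: sum_distrib_right)
      finally show ?thesis by (simp add: k(3))
    qed
    \<comment> \<open>With the lowest non-zero term at \<open>j\<close>, the factor
      \<open>a ^ j\<close> can be cancelled on the right; what remains is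
      \<open>k j + s * a = 0\<close>, which exhibits the inverse of \<open>a\<close>.\<close>
    define j where "j = (LEAST i. k i \<noteq> 0)"
    have j: "k j \<noteq> 0" "j \<le> n"
      using k(2) unfolding j_def by (metis (mono_tags, lifting) LeastI Least_le order_trans)+
    have j_least: "k i = 0" if "i < j" for i
      using that not_less_Least by (auto simp: j_def)
    define s where "s = (\<Sum>i\<in>{j<..n}. k i * a ^ (i - Suc j))"
    have "(\<Sum>i\<le>n. k i * a ^ i) = (\<Sum>i\<in>{j..n}. k i * a ^ i)"
      by (rule sum.mono_neutral_right) (auto intro: j_least simp: not_le)
    also have "{j..n} = insert j {j<..n}"
      using j by auto
    also have "(\<Sum>i\<in>insert j {j<..n}. k i * a ^ i) = k j * a ^ j + (\<Sum>i\<in>{j<..n}. k i * a ^ i)"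
      by simp
    also have "(\<Sum>i\<in>{j<..n}. k i * a ^ i) = (\<Sum>i\<in>{j<..n}. k i * a ^ (i - Suc j) * a * a ^ j)"
      by (intro sum.cong refl) (simp add: mult.assoc flip: power_Suc power_add)
    also have "\<dots> = s * a * a ^ j"
      by (simp add: s_def sum_distrib_right)
    finally have "(k j + s * a) * a ^ j = 0"
      using rel by (simp add: algebra_simps)
    then have "k j = - s * a"
      using \<open>a \<noteq> 0\<close> by (simp add: eq_neg_iff_add_eq_0)
    then have "inverse (k j) * - s * a = 1"
      using j by (simp add: mult.assoc)
    then have "inverse a = inverse (k j) * - s"
      by (metis inverse_unique inverse_inverse_eq inverse_eq_iff_eq right_inverse left_inverse mult.assoc mult.right_neutral mult_1 a(2))
    also have "\<dots> \<in> lspan K B"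
      unfolding s_def using k j pow
      by (intro lspan_scale lspan_minus lspan_sum K division_subringD[OF K]) auto
    finally show ?thesis .
  qed
  then show ?thesis
    using one mult lspan_zero[OF K] lspan_add[OF K] lspan_minus[OF K]
    by (auto simp: division_subring_def)
qed

section \<open>Roots of polynomials over a commutative division subring\<close>

text \<open>Horner division by \<open>x - a\<close>, with polynomials as coefficient functions
  evaluated on \<open>K\<close>. The clause on \<open>b n\<close> preserves the leading coefficient,
  so that the division can be iterated.\<close>

lemma root_factor:
  assumes K: "division_subring K" and comm: "\<And>x y. x \<in> K \<Longrightarrow> y \<in> K \<Longrightarrow> x * y = y * x"
    and a: "a \<in> K" and "\<And>i. i \<le> Suc n \<Longrightarrow> c i \<in> K"
  shows "\<exists>b. (\<forall>i\<le>n. b i \<in> K) \<and> b n = c (Suc n) \<and>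
    (\<forall>x\<in>K. (\<Sum>i\<le>Suc n. c i * x ^ i) - (\<Sum>i\<le>Suc n. c i * a ^ i) = (\<Sum>i\<le>n. b i * x ^ i) * (x - a))"
  using assms(4)
proof (induction n arbitrary: c)
  case 0
  then show ?case
    by (intro exI[of _ "\<lambda>_. c 1"]) (auto simp: algebra_simps)
next
  case (Suc n)
  note K' = division_subringD[OF K]
  define c' where "c' i = c (Suc i)" for i
  define q where "q x = (\<Sum>i\<le>Suc n. c' i * x ^ i)" for x
  have "\<And>i. i \<le> Suc n \<Longrightarrow> c' i \<in> K"
    using Suc.prems by (auto simp: c'_def)
  from Suc.IH[of c', OF this] obtain r where r: "\<And>i. i \<le> n \<Longrightarrow> r i \<in> K" "r n = c' (Suc n)"
    "\<And>x. x \<in> K \<Longrightarrow> q x - q a = (\<Sum>i\<le>n. r i * x ^ i) * (x - a)"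
    by (auto simp: q_def)
  \<comment> \<open>These are the coefficients of \<open>q\<close> plus \<open>a\<close> times the
    quotient of \<open>q\<close>; that quotient has degree bound \<open>n\<close>, so the top
    coefficient is that of \<open>q\<close>.\<close>
  define b where "b i = (if i \<le> n then c' i + r i * a else c' i)" for i
  have bK: "b i \<in> K" if "i \<le> Suc n" for i
    using that Suc.prems r(1) a by (auto simp: b_def c'_def intro!: K')
  have p: "(\<Sum>i\<le>Suc (Suc n). c i * x ^ i) = c 0 + q x * x" for x
    by (simp only: sum.atMost_Suc_shift[of _ "Suc n"] q_def c'_def power_Suc2 sum_distrib_right mult.assoc) simp
  have "(\<Sum>i\<le>Suc (Suc n). c i * x ^ i) - (\<Sum>i\<le>Suc (Suc n). c i * a ^ i) =
      (\<Sum>i\<le>Suc n. b i * x ^ i) * (x - a)" if x: "x \<in> K" for x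
  proof -
    define R where "R = (\<Sum>i\<le>n. r i * x ^ i)"
    have ax: "(x - a) * a = a * (x - a)"
      using comm[OF x a] by (simp add: algebra_simps)
    have "R * a = (\<Sum>i\<le>n. r i * a * x ^ i)"
      unfolding R_def sum_distrib_right mult.assoc
      using comm[OF a division_subring_power[OF K x]] by simp
    then have b: "(\<Sum>i\<le>Suc n. b i * x ^ i) = q x + R * a"
      by (simp add: q_def b_def sum.distrib algebra_simps)
    have "(c 0 + q x * x) - (c 0 + q a * a) = q x * (x - a) + (q x - q a) * a"
      by (simp add: algebra_simps)
    also have "(q x - q a) * a = R * a * (x - a)"
      using r(3)[OF x] ax by (simp add: R_def mult.assoc)
    finally show ?thesis
      unfolding p b by (simp add: algebra_simps)
  qed
  then show ?case
    using bK by (intro exI[of _ b]) (auto simp: b_def c'_def)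
qed

text \<open>Splitting off one root \<open>a\<close> leaves a cofactor of lower degree with the same
  leading coefficient, and every root other than \<open>a\<close> is a root of it because there are
  no zero divisors.\<close>

lemma finite_roots_lead_coeff:
  assumes K: "division_subring K" and comm: "\<And>x y. x \<in> K \<Longrightarrow> y \<in> K \<Longrightarrow> x * y = y * x"
    and "\<And>i. i \<le> n \<Longrightarrow> c i \<in> K" "c n \<noteq> 0"
  shows "finite {x \<in> K. (\<Sum>i\<le>n. c i * x ^ i) = 0}"
  using assms(3,4)
proof (induction n arbitrary: c)
  case (Suc n)
  show ?case
  proof (cases "{x \<in> K. (\<Sum>i\<le>Suc n. c i * x ^ i) = 0} = {}")
    case True
    then show ?thesis by (simp only: finite.emptyI)
  next
    case False
    then obtain a where a: "a \<in> K" "(\<Sum>i\<le>Suc n. c i * a ^ i) = 0"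
      by blast
    obtain b where b: "\<And>i. i \<le> n \<Longrightarrow> b i \<in> K" "b n = c (Suc n)"
      "\<And>x. x \<in> K \<Longrightarrow> (\<Sum>i\<le>Suc n. c i * x ^ i) = (\<Sum>i\<le>n. b i * x ^ i) * (x - a)"
      using root_factor[OF K comm a(1), of n c] Suc.prems(1) unfolding a(2) diff_zero by blast
    have "{x \<in> K. (\<Sum>i\<le>Suc n. c i * x ^ i) = 0} \<subseteq> insert a {x \<in> K. (\<Sum>i\<le>n. b i * x ^ i) = 0}"
      using b(3) by auto
    moreover have "finite {x \<in> K. (\<Sum>i\<le>n. b i * x ^ i) = 0}"
      using b Suc.prems by (intro Suc.IH) auto
    ultimately show ?thesis
      by (meson finite.insertI finite_subset)
  qed
qed auto

lemma finite_roots: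
  assumes "division_subring K" and "\<And>x y. x \<in> K \<Longrightarrow> y \<in> K \<Longrightarrow> x * y = y * x"
    and c: "\<And>i. i \<le> n \<Longrightarrow> c i \<in> K" "\<exists>i\<le>n. c i \<noteq> 0"
  shows "finite {x \<in> K. (\<Sum>i\<le>n. c i * x ^ i) = 0}"
proof -
  \<comment> \<open>The actual degree: coefficients between \<open>d\<close> and \<open>n\<close>
    vanish.\<close>
  define d where "d = (GREATEST i. i \<le> n \<and> c i \<noteq> 0)"
  have d: "d \<le> n \<and> c d \<noteq> 0"
    unfolding d_def using c(2) by (rule GreatestI_ex_nat[where b = n]) blast
  have "c i = 0" if "i \<le> n" "d < i" for i
    using that Greatest_le_nat[of "\<lambda>i. i \<le> n \<and> c i \<noteq> 0" i n] unfolding d_def by linarith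
  then have "(\<Sum>i\<le>n. c i * x ^ i) = (\<Sum>i\<le>d. c i * x ^ i)" for x
    using d by (intro sum.mono_neutral_right) auto
  then show ?thesis
    using finite_roots_lead_coeff[OF assms(1,2), of d c] c(1) d by auto
qed

text \<open>Artin--Dedekind independence, with elements of the crossed product in place of characters.\<close>

lemma normalizing_elements_independent:
  assumes K: "division_subring K" and comm: "\<And>x y. x \<in> K \<Longrightarrow> y \<in> K \<Longrightarrow> x * y = y * x"
    and "finite S" and u: "\<And>i. i \<in> S \<Longrightarrow> u i \<noteq> 0" "\<And>i x. i \<in> S \<Longrightarrow> x \<in> K \<Longrightarrow> conjg (u i) x \<in> K"
    and dist: "\<And>i j. i \<in> S \<Longrightarrow> j \<in> S \<Longrightarrow> i \<noteq> j \<Longrightarrow> \<exists>x\<in>K. conjg (u i) x \<noteq> conjg (u j) x"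
    and "\<And>i. i \<in> S \<Longrightarrow> k i \<in> K" "(\<Sum>i\<in>S. k i * u i) = 0"
  shows "\<forall>i\<in>S. k i = 0"
  using assms(3-)
proof (induction S arbitrary: k rule: finite_induct)
  case (insert s S)
  note K' = division_subringD[OF K]
  have ks: "k s * u s = - (\<Sum>i\<in>S. k i * u i)"
    using insert.hyps insert.prems(5) by (simp add: eq_neg_iff_add_eq_0)
  have *: "\<forall>i\<in>S. k i * (conjg (u i) x - conjg (u s) x) = 0" if x: "x \<in> K" for x
  proof -
    let ?y = "conjg (u s) x"
    have y: "?y \<in> K"
      using insert.prems x by auto
    have move: "k i * (u i * x) = k i * (conjg (u i) x * u i)" if "i \<in> insert s S" for i
      using insert.prems(1)[OF that] by (simp add: mult.assoc conjg_mult_right)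
    have yk: "k i * (?y * u i) = ?y * (k i * u i)" if "i \<in> insert s S" for i
      using comm[OF y insert.prems(4)[OF that]] by (simp flip: mult.assoc)
    \<comment> \<open>The given relation times \<open>x\<close> on the right, minus
      \<open>?y\<close> times it on the left: the term of \<open>s\<close> cancels, which leaves a
      shorter relation for the induction hypothesis.\<close>
    have "(\<Sum>i\<in>S. k i * (conjg (u i) x - ?y) * u i) = (\<Sum>i\<in>S. k i * u i * x) - ?y * (\<Sum>i\<in>S. k i * u i)"
      using yk by (simp add: sum_distrib_left sum_subtractf move left_diff_distrib right_diff_distrib mult.assoc)
    also have "\<dots> = - (k s * u s) * x + ?y * (k s * u s)"
      by (simp add: ks sum_distrib_right)
    also have "\<dots> = 0"
      using move[of s] yk[of s] insert.prems(1)[of s] by (simp add: mult.assoc)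
    finally have "(\<Sum>i\<in>S. k i * (conjg (u i) x - ?y) * u i) = 0" .
    then show ?thesis
      using insert.prems x y by (intro insert.IH) (auto intro!: K')
  qed
  have "k i = 0" if "i \<in> S" for i
  proof -
    obtain x where "x \<in> K" "conjg (u i) x \<noteq> conjg (u s) x"
      using insert.prems(3)[of i s] insert.hyps \<open>i \<in> S\<close> by blast
    then show ?thesis
      using * that by auto
  qed
  moreover from this have "k s = 0"
    using ks insert.prems(1)[of s] by simp
  ultimately show ?case by simp
qed auto

text \<open>The pairs represent an element of \<open>K \<otimes> K\<close>, namely the product over \<open>\<sigma> \<in> S\<close> of the elements
  \<open>(1 \<otimes> \<sigma> x - x \<otimes> 1) / (\<sigma> x - x)\<close> for some \<open>x\<close> moved by \<open>\<sigma>\<close>.\<close>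

lemma separating_pairs:
  assumes K: "division_subring K" and comm: "\<And>x y. x \<in> K \<Longrightarrow> y \<in> K \<Longrightarrow> x * y = y * x"
    and "finite S" and "\<forall>\<sigma>\<in>S. \<forall>x\<in>K. \<sigma> x \<in> K"
    and "\<forall>\<sigma>\<in>S. \<forall>x\<in>K. \<forall>y\<in>K. \<sigma> (x * y) = \<sigma> x * \<sigma> y"
    and "\<forall>\<sigma>\<in>S. \<exists>x\<in>K. \<sigma> x \<noteq> x"
  shows "\<exists>ps. set ps \<subseteq> K \<times> K \<and> (\<Sum>(x, y)\<leftarrow>ps. x * y) = 1 \<and> (\<forall>\<sigma>\<in>S. (\<Sum>(x, y)\<leftarrow>ps. \<sigma> x * y) = 0)"
  using assms(3-)
proof (induction S rule: finite_induct)
  case empty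
  then show ?case
    using division_subringD[OF K] by (intro exI[of _ "[(1, 1)]"]) auto
next
  case (insert \<sigma> S)
  note K' = division_subringD[OF K]
  obtain ps where ps: "set ps \<subseteq> K \<times> K" "(\<Sum>(x, y)\<leftarrow>ps. x * y) = 1"
    "\<And>\<gamma>. \<gamma> \<in> S \<Longrightarrow> (\<Sum>(x, y)\<leftarrow>ps. \<gamma> x * y) = 0"
  proof -
    have "\<exists>ps. set ps \<subseteq> K \<times> K \<and> (\<Sum>(x, y)\<leftarrow>ps. x * y) = 1 \<and> (\<forall>\<sigma>\<in>S. (\<Sum>(x, y)\<leftarrow>ps. \<sigma> x * y) = 0)"
      using insert.prems by (intro insert.IH) simp_all
    then show thesis
      using that by blast
  qed
  obtain x0 where x0: "x0 \<in> K" "\<sigma> x0 \<noteq> x0"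
    using insert.prems(3) by auto
  define s where "s = \<sigma> x0"
  define d where "d = inverse (s - x0)"
  have sd: "s \<in> K" "d \<in> K"
    using insert.prems(1) x0 by (auto simp: s_def d_def intro!: K')
  \<comment> \<open>Multiplication of the tensor by \<open>d\<close> times
    \<open>1 \<otimes> s - x0 \<otimes> 1\<close>.\<close>
  define qs where "qs ps = map (\<lambda>(x, y). (x, d * s * y)) ps @ map (\<lambda>(x, y). (x0 * x, - d * y)) ps" for ps
  \<comment> \<open>The new factor evaluates to 1 at the identity, by the choice of
    \<open>d\<close>, and to 0 at \<open>\<sigma>\<close>; zeros already obtained on
    \<open>S\<close> persist.\<close>
  have ev: "(\<Sum>(x, y)\<leftarrow>qs ps. \<gamma> x * y) = d * (s - \<gamma> x0) * (\<Sum>(x, y)\<leftarrow>ps. \<gamma> x * y)"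
    if \<gamma>: "\<And>x. x \<in> K \<Longrightarrow> \<gamma> x \<in> K" "\<And>x y. x \<in> K \<Longrightarrow> y \<in> K \<Longrightarrow> \<gamma> (x * y) = \<gamma> x * \<gamma> y"
      and "set ps \<subseteq> K \<times> K" for \<gamma> ps
    using that(3)
  proof (induction ps)
    case (Cons p ps)
    obtain x y where p: "p = (x, y)" "x \<in> K" "y \<in> K"
      using Cons.prems by (cases p) auto
    define t g where "t = \<gamma> x" and "g = \<gamma> x0"
    have tg: "t \<in> K" "g \<in> K"
      using p x0 \<gamma> by (auto simp: t_def g_def)
    have "t * (d * s) = d * s * t" "g * t * d = d * (g * t)"
      using sd tg by (auto intro!: comm K')
    then have "t * (d * s) * y = d * s * t * y" "g * t * d * y = d * (g * t) * y"
      by simp_all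
    then have "t * (d * s * y) + g * t * (- d * y) = d * (s - g) * (t * y)"
      by (simp add: left_diff_distrib right_diff_distrib mult.assoc)
    moreover have "(\<Sum>(x, y)\<leftarrow>qs (p # ps). \<gamma> x * y) =
        t * (d * s * y) + g * t * (- d * y) + (\<Sum>(x, y)\<leftarrow>qs ps. \<gamma> x * y)"
      using p x0 by (simp add: qs_def \<gamma>(2) t_def g_def)
    moreover have "(\<Sum>(x, y)\<leftarrow>p # ps. \<gamma> x * y) = t * y + (\<Sum>(x, y)\<leftarrow>ps. \<gamma> x * y)"
      by (simp add: p t_def)
    ultimately show ?case
      using Cons by (simp add: distrib_left flip: g_def)
  qed (simp add: qs_def)
  have "set (qs ps) \<subseteq> K \<times> K"
    using ps(1) x0 sd by (auto simp: qs_def intro!: K')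
  moreover have "(\<Sum>(x, y)\<leftarrow>qs ps. x * y) = 1"
    using ev[of "\<lambda>x. x" ps, OF _ _ ps(1)] ps(2) x0 by (simp add: d_def s_def)
  moreover have "(\<Sum>(x, y)\<leftarrow>qs ps. \<gamma> x * y) = 0" if "\<gamma> \<in> insert \<sigma> S" for \<gamma>
    using ev[of \<gamma> ps, OF _ _ ps(1)] insert.prems(1,2) ps(3)[of \<gamma>] that by (auto simp: s_def)
  ultimately show ?case by blast
qed

section \<open>From a finite group of automorphisms to finite dimension over the center\<close>

lemma division_subring_center: "division_subring (center :: 'a::division_ring set)"
  using division_subring_centralizer[of "UNIV :: 'a set"] by (simp add: center_def centralizer_def)

lemma finite_dim_over_center_if_finite_lspan:
  assumes "finite B" "lspan center B = (UNIV :: 'a::division_ring set)"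
  shows "finite_dim_over_center TYPE('a)"
  using assms unfolding finite_dim_over_center_def lspan_def by blast

text \<open>The elements of \<open>U\<close> represent a finite group acting on \<open>K\<close> by conjugation. Its fixed field is
  the center, and the trace of this action gives the finite dimension of \<open>K\<close> over the center.\<close>

lemma finite_dim_over_center_if_finite_normalizing_set:
  fixes K U :: "'a::division_ring set"
  assumes K: "division_subring K" and comm: "\<And>x y. x \<in> K \<Longrightarrow> y \<in> K \<Longrightarrow> x * y = y * x"
    and U: "finite U" "0 \<notin> U" "1 \<in> U"
    and norm: "\<And>u x. u \<in> U \<Longrightarrow> x \<in> K \<Longrightarrow> conjg u x \<in> K"
    and closed: "\<And>u v. u \<in> U \<Longrightarrow> v \<in> U \<Longrightarrow> \<exists>w\<in>U. \<exists>k\<in>K. u * v = k * w"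
    and gen: "div_subring_gen (K \<union> U) = UNIV"
  shows "finite_dim_over_center TYPE('a)"
proof -
  note K' = division_subringD[OF K]
  have base: "k * u \<in> lspan K U" if "k \<in> K" "u \<in> U" for k u
    using that U by (intro lspan_scale lspan_base K)
  \<comment> \<open>Elements of \<open>U\<close> move past \<open>K\<close> by conjugation and
    multiply into \<open>K\<close> times \<open>U\<close>, so the span is closed under products.
    Being finite-dimensional over \<open>K\<close>, it is a division subring, and it contains the
    generators.\<close>
  have spanU: "lspan K U = UNIV"
  proof -
    have "x * y \<in> lspan K U" if xy: "x \<in> lspan K U" "y \<in> lspan K U" for x y
    proof -
      obtain c where c: "\<And>u. u \<in> U \<Longrightarrow> c u \<in> K" "x = (\<Sum>u\<in>U. c u * u)"
        using lspanE[OF xy(1)] by metis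
      obtain d where d: "\<And>u. u \<in> U \<Longrightarrow> d u \<in> K" "y = (\<Sum>u\<in>U. d u * u)"
        using lspanE[OF xy(2)] by metis
      have "c u * u * (d v * v) \<in> lspan K U" if uv: "u \<in> U" "v \<in> U" for u v
      proof -
        obtain w k where wk: "w \<in> U" "k \<in> K" "u * v = k * w"
          using closed[OF uv] by blast
        have "u \<noteq> 0" using uv U by blast
        then have "c u * u * (d v * v) = c u * conjg u (d v) * (u * v)"
          by (simp add: mult.assoc) (simp add: conjg_mult_right flip: mult.assoc)
        also have "\<dots> = c u * conjg u (d v) * k * w"
          by (simp add: wk(3) mult.assoc)
        also have "\<dots> \<in> lspan K U"
          using uv wk by (intro base K' norm c d)
        finally show ?thesis .
      qed
      then show ?thesis
        unfolding c(2) d(2) sum_product by (intro lspan_sum K)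
    qed
    moreover have "1 \<in> lspan K U"
      using base[of 1 1] U K' by simp
    ultimately have "division_subring (lspan K U)"
      using K U by (intro division_subring_lspan)
    moreover have "K \<union> U \<subseteq> lspan K U"
      using base[of _ 1] base[of 1] U K' by auto
    ultimately show ?thesis
      using div_subring_gen_least gen by blast
  qed

  \<comment> \<open>Restricting to \<open>K\<close> identifies elements of \<open>U\<close> with the
    same action, so that the trace \<open>T\<close> counts each automorphism once.\<close>
  define G where "G = (\<lambda>u. restrict (conjg u) K) ` U"
  define T where "T z = (\<Sum>\<gamma>\<in>G. \<gamma> z)" for z
  have G: "finite G"
    using U by (simp add: G_def)
  have GK: "\<gamma> x \<in> K" if "\<gamma> \<in> G" "x \<in> K" for \<gamma> x
    using that norm by (auto simp: G_def)
  have T_center: "T z \<in> center" if z: "z \<in> K" for z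
  proof -
    have "conjg v (T z) = T z" if v: "v \<in> U" for v
    proof -
      have nz: "v \<noteq> 0" using v U by blast
      \<comment> \<open>Composition with conjugation by \<open>v\<close>. It permutes
        \<open>G\<close>: by \<open>closed\<close>, \<open>v * u\<close> is \<open>k * w\<close>,
        and conjugation by \<open>k\<close> is trivial on the commutative \<open>K\<close>. Hence
        \<open>T z\<close> is fixed by \<open>v\<close>.\<close>
      define h where "h \<gamma> = restrict (\<lambda>x. conjg v (\<gamma> x)) K" for \<gamma>
      have "h \<gamma> \<in> G" if "\<gamma> \<in> G" for \<gamma>
      proof -
        obtain u where u: "u \<in> U" "\<gamma> = restrict (conjg u) K"
          using \<open>\<gamma> \<in> G\<close> by (auto simp: G_def)
        obtain w k where wk: "w \<in> U" "k \<in> K" "v * u = k * w"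
          using closed[OF v u(1)] by blast
        have nz': "u \<noteq> 0" "k \<noteq> 0" "w \<noteq> 0"
          using u wk U nz by (metis mult_eq_0_iff)+
        have "conjg v (conjg u x) = conjg w x" if x: "x \<in> K" for x
        proof -
          have "conjg v (conjg u x) = conjg k (conjg w x)"
            using nz nz' by (simp add: wk(3) flip: conjg_mult_left)
          also have "\<dots> = conjg w x"
            using nz' comm[OF wk(2) norm[OF wk(1) x]] by (simp add: conjg_eq_iff)
          finally show ?thesis .
        qed
        then have "h \<gamma> = restrict (conjg w) K"
          by (auto simp: h_def u(2) restrict_def)
        then show ?thesis
          using wk(1) by (simp add: G_def)
      qed
      moreover have inj: "inj_on h G"
      proof (rule inj_onI)
        fix \<gamma> \<delta> assume "\<gamma> \<in> G" "\<delta> \<in> G" and eq: "h \<gamma> = h \<delta>"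
        then have ext: "\<gamma> \<in> extensional K" "\<delta> \<in> extensional K"
          by (auto simp: G_def)
        have "\<gamma> x = \<delta> x" if x: "x \<in> K" for x
        proof -
          have "conjg v (\<gamma> x) = conjg v (\<delta> x)"
            using fun_cong[OF eq, of x] x by (simp add: h_def)
          then show ?thesis
            using conjg_inverse_left[OF nz] by metis
        qed
        then show "\<gamma> = \<delta>"
          using ext by (intro extensionalityI)
      qed
      ultimately have "h ` G = G"
        using G by (intro endo_inj_surj) auto
      then have "bij_betw h G G"
        using inj by (simp add: bij_betw_def)
      then have "T z = (\<Sum>\<gamma>\<in>G. h \<gamma> z)"
        unfolding T_def by (rule sum.reindex_bij_betw[symmetric])
      also have "\<dots> = conjg v (T z)"
        using z by (simp add: T_def conjg_sum h_def)
      finally show ?thesis ..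
    qed
    then have "v * T z = T z * v" if "v \<in> U" for v
      using that U(2) by (metis conjg_eq_iff)
    moreover have "T z \<in> K"
      unfolding T_def using GK z by (intro division_subring_sum K)
    ultimately have "K \<union> U \<subseteq> centralizer {T z}"
      using comm by (auto simp: centralizer_def)
    then have "centralizer {T z} = UNIV"
      using div_subring_gen_least[OF division_subring_centralizer] gen by blast
    then have "x \<in> centralizer {T z}" for x
      by simp
    then show ?thesis
      by (simp add: centralizer_def center_def)
  qed

  define e where "e = restrict (conjg 1) K"
  have eG: "e \<in> G" and e: "\<And>x. x \<in> K \<Longrightarrow> e x = x"
    using U by (auto simp: e_def G_def conjg_one_left)
  have G_mult: "\<gamma> (x * y) = \<gamma> x * \<gamma> y" if "\<gamma> \<in> G" "x \<in> K" "y \<in> K" for \<gamma> x y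
  proof -
    obtain u where "u \<in> U" "\<gamma> = restrict (conjg u) K"
      using \<open>\<gamma> \<in> G\<close> by (auto simp: G_def)
    moreover have "u \<noteq> 0" using \<open>u \<in> U\<close> U by blast
    ultimately show ?thesis
      using that K' by (simp add: conjg_mult)
  qed
  have "\<exists>x\<in>K. \<gamma> x \<noteq> x" if \<gamma>: "\<gamma> \<in> G - {e}" for \<gamma>
  proof (rule ccontr)
    assume "\<not> ?thesis"
    then have "\<gamma> = e"
      using \<gamma> e by (intro extensionalityI[of _ K]) (auto simp: G_def e_def)
    then show False using \<gamma> by simp
  qed
  then have "\<exists>ps. set ps \<subseteq> K \<times> K \<and> (\<Sum>(x, y)\<leftarrow>ps. x * y) = 1 \<and>
      (\<forall>\<sigma>\<in>G - {e}. (\<Sum>(x, y)\<leftarrow>ps. \<sigma> x * y) = 0)"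
    using G GK G_mult K comm by (intro separating_pairs) blast+
  then obtain ps where ps: "set ps \<subseteq> K \<times> K" "(\<Sum>(x, y)\<leftarrow>ps. x * y) = 1"
      "\<And>\<sigma>. \<sigma> \<in> G - {e} \<Longrightarrow> (\<Sum>(x, y)\<leftarrow>ps. \<sigma> x * y) = 0"
    by blast
  define Y where "Y = snd ` set ps"
  have Y: "finite Y" by (simp add: Y_def)
  \<comment> \<open>The inner sums over \<open>ps\<close> are 1 at \<open>e\<close> and 0 elsewhere
    on \<open>G\<close>, so \<open>z\<close> is the sum of \<open>\<gamma> z\<close> times these.
    Exchanging the sums writes \<open>z\<close> with trace coefficients \<open>T (z * x)\<close>,
    which are central.\<close>
  have K_span: "z \<in> lspan center Y" if z: "z \<in> K" for z
  proof -
    have ev_e: "(\<Sum>(x, y)\<leftarrow>ps. e x * y) = 1"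
    proof -
      have "map (\<lambda>(x, y). e x * y) ps = map (\<lambda>(x, y). x * y) ps"
        using ps(1) e by (intro map_cong) auto
      then show ?thesis using ps(2) by (simp only:)
    qed
    have "(\<Sum>\<gamma>\<in>G. \<gamma> z * (\<Sum>(x, y)\<leftarrow>ps. \<gamma> x * y)) = (\<Sum>\<gamma>\<in>{e}. \<gamma> z * (\<Sum>(x, y)\<leftarrow>ps. \<gamma> x * y))"
      using G eG ps(3) by (intro sum.mono_neutral_right) auto
    then have "z = (\<Sum>\<gamma>\<in>G. \<gamma> z * (\<Sum>(x, y)\<leftarrow>ps. \<gamma> x * y))"
      using e[OF z] ev_e by simp
    also have "\<dots> = (\<Sum>(x, y)\<leftarrow>ps. T (z * x) * y)"
      using ps(1)
    proof (induction ps)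
      case (Cons p ps)
      obtain x y where p: "p = (x, y)" "x \<in> K"
        using Cons.prems by (cases p) auto
      have "(\<Sum>\<gamma>\<in>G. \<gamma> z * (\<gamma> x * y)) = T (z * x) * y"
        using z p by (simp add: T_def sum_distrib_right G_mult mult.assoc)
      then show ?case
        using Cons by (simp add: p distrib_left sum.distrib)
    qed simp
    also have "\<dots> \<in> lspan center Y"
    proof -
      have "T (z * x) * y \<in> lspan center Y" if "(x, y) \<in> set ps" for x y
      proof (intro lspan_scale lspan_base division_subring_center T_center K' Y)
        show "x \<in> K" "y \<in> Y"
          using that ps(1) by (force simp: Y_def)+
      qed (rule z)
      then show ?thesis
        by (induction ps) (auto intro: lspan_zero lspan_add division_subring_center)
    qed
    finally show ?thesis .
  qed

  define B where "B = (\<lambda>(y, u). y * u) ` (Y \<times> U)"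
  have B: "finite B" using Y U by (simp add: B_def)
  have "k * u \<in> lspan center B" if "k \<in> K" "u \<in> U" for k u
  proof -
    obtain f where f: "\<And>y. y \<in> Y \<Longrightarrow> f y \<in> center" "k = (\<Sum>y\<in>Y. f y * y)"
      using lspanE[OF K_span[OF \<open>k \<in> K\<close>]] by metis
    have "f y * (y * u) \<in> lspan center B" if "y \<in> Y" for y
      using that \<open>u \<in> U\<close> f(1) B
      by (intro lspan_scale lspan_base division_subring_center) (auto simp: B_def)
    then show ?thesis
      unfolding f(2) sum_distrib_right mult.assoc by (intro lspan_sum division_subring_center)
  qed
  then have "x \<in> lspan center B" if "x \<in> lspan K U" for x
    using that by (elim lspanE) (auto intro: lspan_sum division_subring_center)
  then show ?thesis
    using spanU B by (intro finite_dim_over_center_if_finite_lspan[of B]) auto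
qed

theorem theorem2p6:
  fixes M :: "'a::division_ring set"
  assumes noncomm: "\<exists>x y::'a. x * y \<noteq> y * x"
    and irr: "irreducible_subgroup M"
    and meta: "metabelian M"
    and locsolv: "locally_solvable M"
    and maxl: "maximal_subgroup M"
    and alg: "\<exists>\<alpha>\<in>M - center. algebraic_over_center \<alpha>"
  shows "finite_dim_over_center TYPE('a)"
proof -
  have M: "0 \<notin> M" "1 \<in> M" "\<And>x y. x \<in> M \<Longrightarrow> y \<in> M \<Longrightarrow> x * y \<in> M" "\<And>x. x \<in> M \<Longrightarrow> inverse x \<in> M"
    using maxl by (auto simp: maximal_subgroup_def subgroup_units_grp_iff)
  have M_nz: "x \<noteq> 0" if "x \<in> M" for x
    using that M(1) by blast
  have meta': "conjg a b * inverse b * (conjg c d * inverse d) = conjg c d * inverse d * (conjg a b * inverse b)"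
    if "a \<in> M" "b \<in> M" "c \<in> M" "d \<in> M" for a b c d
    using meta commutator_in_derived[OF M(1)] that by (auto simp: metabelian_def)
  have comm_if_units_subset: "x * y = y * x"
    if "division_subring C" "C - {0} \<subseteq> M" "x \<in> C" "y \<in> C" for C x y
    using that(1) _ that(3,4) by (rule metabelian_division_subring_commute) (use that(2) in \<open>auto intro!: meta'\<close>)
  have center_comm: "z * x = x * z" if "z \<in> center" for z x :: 'a
    using that by (simp add: center_def)

  \<comment> \<open>Construction of the self-centralizing field \<open>K\<close>\<close>
  define X where "X = {conjg a b * inverse b |a b. a \<in> M \<and> b \<in> M}"
  define \<A> where "\<A> = {A. X \<subseteq> A \<and> A \<subseteq> M \<and> (\<forall>x\<in>A. \<forall>y\<in>A. x * y = y * x)}"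
  have X: "X \<subseteq> M"
    using M by (auto simp: X_def conjg_def)
  have "\<exists>A\<in>\<A>. \<forall>B\<in>\<A>. A \<subseteq> B \<longrightarrow> B = A"
  proof (rule subset_Zorn_nonempty)
    have "X \<in> \<A>"
      using X by (auto simp: \<A>_def X_def intro!: meta')
    then show "\<A> \<noteq> {}" by blast
  next
    fix \<C> assume \<C>: "\<C> \<noteq> {}" "subset.chain \<A> \<C>"
    have "x * y = y * x" if "A \<in> \<C>" "x \<in> A" "B \<in> \<C>" "y \<in> B" for A B x y
    proof -
      have "A \<in> \<A>" "B \<in> \<A>" "A \<subseteq> B \<or> B \<subseteq> A"
        using \<C>(2) that by (auto simp: subset.chain_def subset_chain_def)
      then show ?thesis
        using that unfolding \<A>_def by blast
    qed
    then have "\<forall>x\<in>\<Union>\<C>. \<forall>y\<in>\<Union>\<C>. x * y = y * x"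
      by blast
    moreover have "X \<subseteq> B" "B \<subseteq> M" if "B \<in> \<C>" for B
      using \<C>(2) that by (auto simp: subset_chain_def \<A>_def)
    then have "X \<subseteq> \<Union>\<C>" "\<Union>\<C> \<subseteq> M"
      using \<C>(1) by fast+
    ultimately show "\<Union>\<C> \<in> \<A>"
      unfolding \<A>_def by simp
  qed
  then obtain A where "A \<in> \<A>" and A_max: "\<And>B. B \<in> \<A> \<Longrightarrow> A \<subseteq> B \<Longrightarrow> B = A"
    by blast
  then have A: "X \<subseteq> A" "A \<subseteq> M" "\<And>x y. x \<in> A \<Longrightarrow> y \<in> A \<Longrightarrow> x * y = y * x"
    by (simp_all add: \<A>_def)
  have A_self_centralizing: "m \<in> A" if "m \<in> M" "\<And>a. a \<in> A \<Longrightarrow> m * a = a * m" for m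
  proof -
    have "insert m A \<in> \<A>"
      using that A by (auto simp: \<A>_def)
    then show ?thesis
      using A_max[of "insert m A"] by blast
  qed

  define K where "K = div_subring_gen (center \<union> A)"
  have K: "division_subring K"
    by (simp add: K_def division_subring_gen)
  note K' = division_subringD[OF K]
  have AK: "A \<subseteq> K" "center \<subseteq> K"
    using subset_div_subring_gen[of "center \<union> A"] by (auto simp: K_def)
  have K_comm: "x * y = y * x" if "x \<in> K" "y \<in> K" for x y
    using _ that unfolding K_def
    by (rule div_subring_gen_commute) (use A(3) center_comm in \<open>metis Un_iff\<close>)
  \<comment> \<open>A conjugate of \<open>a\<close> is a commutator times \<open>a\<close>, and all
    commutators of \<open>M\<close> lie in \<open>A\<close>.\<close>
  have conjg_M: "conjg m a \<in> K" if "m \<in> M" "a \<in> M" "a \<in> K" for m a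
  proof -
    have "conjg m a * inverse a \<in> K"
      using that A(1) AK by (auto simp: X_def)
    then have "conjg m a * inverse a * a \<in> K"
      using that K' by blast
    then show ?thesis
      using M_nz[OF \<open>a \<in> M\<close>] by (simp add: mult.assoc)
  qed
  have norm: "conjg m x \<in> K" if m: "m \<in> M" and x: "x \<in> K" for m x
  proof -
    have "conjg m y \<in> K" if "y \<in> center \<union> A" for y
    proof (cases "y \<in> center")
      case True
      then have "conjg m y = y"
        using M_nz[OF m] center_comm[of y m] by (simp add: conjg_eq_iff)
      then show ?thesis
        using True AK by auto
    qed (use that m A AK in \<open>auto intro!: conjg_M\<close>)
    then show ?thesis
      using div_subring_gen_conjg[of m "center \<union> A" x] M_nz[OF m] x unfolding K_def by blast
  qed
  \<comment> \<open>Of the three alternatives, \<open>K = UNIV\<close> contradicts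
    non-commutativity. If \<open>K\<close> were central, so would be \<open>A\<close>; then
    \<open>A\<close> would contain all of \<open>M\<close>, against irreducibility.\<close>
  have KM: "K - {0} \<subseteq> M"
  proof -
    have "K \<noteq> UNIV"
      using noncomm K_comm by blast
    moreover have "\<not> K \<subseteq> center"
    proof
      assume "K \<subseteq> center"
      then have "A \<subseteq> center" using AK by blast
      then have "M \<subseteq> A"
        using A_self_centralizing center_comm by (metis subset_iff)
      then have "div_subring_gen (center \<union> M) \<subseteq> center"
        using \<open>A \<subseteq> center\<close> by (intro div_subring_gen_least division_subring_center) blast
      then show False
        using irr noncomm center_comm by (auto simp: irreducible_subgroup_def)
    qed
    ultimately show ?thesis
      using maximal_subgroup_normalizes_division_subring[OF maxl K norm] by blast
  qed
  have K_self_centralizing: "m \<in> K" if "m \<in> M" "\<And>x. x \<in> K \<Longrightarrow> m * x = x * m" for m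
    using A_self_centralizing[of m] that AK by blast
  \<comment> \<open>The quotient of \<open>M\<close> by the units of \<open>K\<close> is abelian,
    stated elementwise.\<close>
  have commutator_K: "\<exists>k\<in>K. m * n = k * (n * m)" if "m \<in> M" "n \<in> M" for m n
  proof
    show "conjg m n * inverse n \<in> K"
      using that A(1) AK by (auto simp: X_def)
    show "m * n = conjg m n * inverse n * (n * m)"
      using that[THEN M_nz] by (simp add: mult.assoc) (simp add: conjg_def mult.assoc flip: mult.assoc[of "inverse n"])
  qed

  obtain \<alpha> where \<alpha>: "\<alpha> \<in> M" "\<alpha> \<notin> center" "algebraic_over_center \<alpha>"
    using alg by blast
  then obtain n c where c: "\<And>i. i \<le> n \<Longrightarrow> c i \<in> center" "\<exists>i\<le>n. c i \<noteq> 0" "(\<Sum>i\<le>n. c i * \<alpha> ^ i) = 0"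
    unfolding algebraic_over_center_def by blast
  have \<alpha>_nz: "\<alpha> \<noteq> 0" using \<alpha> M_nz by blast
  show ?thesis
  proof (cases "\<alpha> \<in> K")
    case True

    \<comment> \<open>The case \<open>\<alpha> \<in> K\<close>: a finite orbit of conjugates\<close>
    define L where "L = (\<lambda>m. conjg m \<alpha>) ` M"
    have LK: "L \<subseteq> K"
      using norm True by (auto simp: L_def)
    have L_conjg: "conjg m x \<in> L" if "m \<in> M" "x \<in> L" for m x
      using that M M_nz by (auto simp: L_def simp flip: conjg_mult_left)
    have "finite {x \<in> K. (\<Sum>i\<le>n. c i * x ^ i) = 0}"
      using c AK by (intro finite_roots K K_comm) auto
    \<comment> \<open>The coefficients are central, so conjugates of \<open>\<alpha>\<close> satisfy
      the same equation.\<close>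
    moreover have "(\<Sum>i\<le>n. c i * x ^ i) = 0" if "x \<in> L" for x
    proof -
      obtain m where m: "m \<in> M" "x = conjg m \<alpha>"
        using \<open>x \<in> L\<close> by (auto simp: L_def)
      have "conjg m (c i) = c i" if "i \<le> n" for i
        using M_nz[OF m(1)] center_comm[OF c(1)[OF that]] by (simp add: conjg_eq_iff)
      then have "(\<Sum>i\<le>n. c i * x ^ i) = conjg m (\<Sum>i\<le>n. c i * \<alpha> ^ i)"
        using M_nz[OF m(1)] by (simp add: conjg_sum conjg_mult conjg_power m(2))
      then show ?thesis
        by (simp add: c(3) conjg_zero)
    qed
    ultimately have L_fin: "finite L"
      using LK by (elim finite_subset[rotated]) blast

    define C where "C = centralizer L"
    have C: "division_subring C"
      by (simp add: C_def division_subring_centralizer)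
    have KC: "K \<subseteq> C"
      using LK K_comm by (auto simp: C_def centralizer_def)
    have \<alpha>L: "\<alpha> \<in> L"
      using M(2) conjg_one_left[of \<alpha>] by (auto simp: L_def intro!: image_eqI[of _ _ 1])
    have "conjg m x \<in> C" if m: "m \<in> M" and x: "x \<in> C" for m x
    proof -
      have "conjg m x * y = y * conjg m x" if y: "y \<in> L" for y
      proof -
        define y' where "y' = conjg (inverse m) y"
        have "y' \<in> L"
          unfolding y'_def using m y M by (intro L_conjg)
        then have "x * y' = y' * x"
          using x by (auto simp: C_def centralizer_def)
        then have "conjg m (x * y') = conjg m (y' * x)" by simp
        moreover have "conjg m y' = y"
          using conjg_inverse_left[of "inverse m" y] M_nz[OF m] by (simp add: y'_def)
        ultimately show ?thesis
          using M_nz[OF m] by (simp add: conjg_mult)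
      qed
      then show ?thesis by (simp add: C_def centralizer_def)
    qed
    then have "C - {0} \<subseteq> M \<or> C = UNIV \<or> C \<subseteq> center"
      using maxl C by (intro maximal_subgroup_normalizes_division_subring)
    \<comment> \<open>\<open>C = UNIV\<close> would make \<open>\<alpha>\<close> central, and so
      would \<open>C \<subseteq> center\<close> because
      \<open>\<alpha> \<in> K \<subseteq> C\<close>.\<close>
    then have CM: "C - {0} \<subseteq> M"
    proof (elim disjE)
      assume "C = UNIV"
      then have \<alpha>_comm: "x * \<alpha> = \<alpha> * x" for x
        using \<alpha>L by (intro centralizerD[of x L]) (simp_all add: C_def)
      have "\<alpha> \<in> center"
        unfolding center_def by (intro CollectI allI \<alpha>_comm[symmetric])
      then show ?thesis using \<alpha> by blast
    next
      assume "C \<subseteq> center"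
      then show ?thesis using \<alpha> True KC by blast
    qed
    have C_comm: "x * y = y * x" if "x \<in> C" "y \<in> C" for x y
      using comm_if_units_subset[OF C CM that] .
    \<comment> \<open>The stabilizer of \<open>\<alpha>\<close> fixes all of \<open>L\<close>:
      \<open>h\<close> and \<open>m\<close> commute up to a factor \<open>k\<close> in
      \<open>K\<close>, which acts trivially on \<open>L \<subseteq> K\<close>. So \<open>h\<close>
      lies in the commutative \<open>C\<close>, which contains \<open>K\<close>, and therefore
      centralizes \<open>K\<close>.\<close>
    have fix_\<alpha>: "h \<in> K" if h: "h \<in> M" "h * \<alpha> = \<alpha> * h" for h
    proof -
      have "h * x = x * h" if x: "x \<in> L" for x
      proof -
        obtain m where m: "m \<in> M" "x = conjg m \<alpha>"
          using \<open>x \<in> L\<close> by (auto simp: L_def)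
        obtain k where k: "k \<in> K" "h * m = k * (m * h)"
          using commutator_K[OF h(1) m(1)] by blast
        have nz: "h \<noteq> 0" "m \<noteq> 0" "k \<noteq> 0"
          using M_nz h(1) m(1) k(2) by (auto simp: M_nz)
        have "conjg h x = conjg k (conjg m (conjg h \<alpha>))"
          using nz by (simp add: m(2) k(2) flip: conjg_mult_left)
        also have "conjg h \<alpha> = \<alpha>"
          using h nz by (simp add: conjg_eq_iff)
        also have "conjg k (conjg m \<alpha>) = x"
          using K_comm[OF k(1), of x] LK x m(2) nz by (auto simp: conjg_eq_iff)
        finally show ?thesis
          using nz by (simp add: conjg_eq_iff)
      qed
      then have "h \<in> C"
        by (simp add: C_def centralizer_def)
      then show ?thesis
        using h(1) KC C_comm by (intro K_self_centralizing) auto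
    qed

    \<comment> \<open>Orbit-stabilizer: one element of \<open>M\<close> for each point of
      \<open>L\<close> represents the cosets of the units of \<open>K\<close>. The element 1 is
      added to \<open>U\<close> since \<open>rep \<alpha>\<close> may be a different representative
      of the trivial coset.\<close>
    define rep where "rep x = (SOME m. m \<in> M \<and> conjg m \<alpha> = x)" for x
    have rep: "rep x \<in> M \<and> conjg (rep x) \<alpha> = x" if "x \<in> L" for x
      unfolding rep_def by (rule someI_ex) (use that in \<open>auto simp: L_def\<close>)
    define U where "U = insert 1 (rep ` L)"
    have UM: "U \<subseteq> M"
      using rep M by (auto simp: U_def)
    have decomp: "\<exists>w\<in>U. \<exists>k\<in>K. m = k * w" if m: "m \<in> M" for m
    proof -
      define w where "w = rep (conjg m \<alpha>)"
      have w: "w \<in> M" "conjg w \<alpha> = conjg m \<alpha>" "w \<in> U"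
        using rep[of "conjg m \<alpha>"] m by (auto simp: w_def L_def U_def)
      define h where "h = inverse w * m"
      have h: "h \<in> M" using w m M by (simp add: h_def)
      have "conjg h \<alpha> = conjg (inverse w) (conjg w \<alpha>)"
        using w m M_nz by (simp add: h_def conjg_mult_left)
      then have "conjg h \<alpha> = \<alpha>"
        using conjg_inverse_left[OF M_nz[OF w(1)], of \<alpha>] by simp
      then have "h \<in> K"
        using h M_nz by (intro fix_\<alpha>) (auto simp: conjg_eq_iff)
      then have "conjg w h \<in> K"
        using norm w by blast
      moreover have "m = conjg w h * w"
        using M_nz[OF w(1)] by (simp add: conjg_mult_right h_def flip: mult.assoc)
      ultimately show ?thesis
        using w by blast
    qed
    show ?thesis
    proof (rule finite_dim_over_center_if_finite_normalizing_set[of K U])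
      show "finite U" "0 \<notin> U" "1 \<in> U"
        using L_fin UM M by (auto simp: U_def)
      show "\<exists>w\<in>U. \<exists>k\<in>K. u * v = k * w" if "u \<in> U" "v \<in> U" for u v
        using that UM by (intro decomp M(3)) auto
      have "M \<subseteq> div_subring_gen (K \<union> U)"
        using decomp subset_div_subring_gen[of "K \<union> U"]
          division_subringD(4)[OF division_subring_gen[of "K \<union> U"]] by blast
      moreover have "center \<subseteq> div_subring_gen (K \<union> U)"
        using AK subset_div_subring_gen[of "K \<union> U"] by blast
      ultimately have "div_subring_gen (center \<union> M) \<subseteq> div_subring_gen (K \<union> U)"
        by (intro div_subring_gen_least division_subring_gen) blast
      then show "div_subring_gen (K \<union> U) = UNIV"
        using irr by (auto simp: irreducible_subgroup_def)
    qed (use K K_comm norm UM in auto)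
  next
    case False

    \<comment> \<open>The case \<open>\<alpha> \<notin> K\<close>: a cyclic group of
      automorphisms\<close>
    have \<alpha>_pow: "\<alpha> ^ i \<in> M" for i
      by (induction i) (use M \<alpha> in auto)
    have "\<exists>m>0. \<alpha> ^ m \<in> K"
    proof (rule ccontr)
      assume no: "\<not> (\<exists>m>0. \<alpha> ^ m \<in> K)"
      \<comment> \<open>If two powers acted alike on \<open>K\<close>, their quotient would
        centralize \<open>K\<close> and hence lie in it. Distinct actions make the powers
        independent over \<open>K\<close>, which the algebraic equation of \<open>\<alpha>\<close>
        contradicts.\<close>
      have lt: "\<exists>x\<in>K. conjg (\<alpha> ^ i) x \<noteq> conjg (\<alpha> ^ j) x" if "i < j" for i j
      proof (rule ccontr)
        assume *: "\<not> ?thesis"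
        have "conjg (\<alpha> ^ (j - i)) x = x" if x: "x \<in> K" for x
        proof -
          have "conjg (\<alpha> ^ i) (conjg (\<alpha> ^ (j - i)) x) = conjg (\<alpha> ^ j) x"
            using \<open>i < j\<close> \<alpha>_nz by (simp flip: conjg_mult_left power_add)
          also have "\<dots> = conjg (\<alpha> ^ i) x"
            using * x by auto
          finally show ?thesis
            using conjg_inverse_left[of "\<alpha> ^ i"] \<alpha>_nz by (metis power_not_zero)
        qed
        then have "\<alpha> ^ (j - i) \<in> K"
          using \<alpha>_nz by (intro K_self_centralizing \<alpha>_pow) (simp add: conjg_eq_iff)
        then show False
          using no \<open>i < j\<close> by (metis zero_less_diff)
      qed
      have "\<forall>i\<in>{..n}. c i = 0"
      proof (rule normalizing_elements_independent[OF K K_comm])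
        show "\<exists>x\<in>K. conjg (\<alpha> ^ i) x \<noteq> conjg (\<alpha> ^ j) x" if "i \<noteq> j" for i j
          using lt[of i j] lt[of j i] that by (metis linorder_neqE_nat)
      qed (use c AK \<alpha>_nz norm \<alpha>_pow in auto)
      then show False
        using c(2) by auto
    qed
    then obtain m where m: "m > 0" "\<alpha> ^ m \<in> K" by blast
    define R where "R = div_subring_gen (K \<union> {\<alpha>})"
    have R: "division_subring R" "K \<subseteq> R" "\<alpha> \<in> R"
      using subset_div_subring_gen[of "K \<union> {\<alpha>}"] by (auto simp: R_def division_subring_gen)
    have "conjg g x \<in> R" if g: "g \<in> M" and x: "x \<in> R" for g x
    proof -
      \<comment> \<open>Commutators lie in \<open>K\<close>, so conjugation by \<open>g\<close> only
        changes \<open>\<alpha>\<close> by a factor from \<open>K\<close>; thus \<open>M\<close>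
        normalizes \<open>R\<close>.\<close>
      obtain k where k: "k \<in> K" "g * \<alpha> = k * (\<alpha> * g)"
        using commutator_K[OF g \<alpha>(1)] by blast
      then have "conjg g \<alpha> = k * \<alpha>"
        using M_nz[OF g] by (simp add: conjg_eq_iff mult.assoc)
      then have "conjg g y \<in> R" if "y \<in> K \<union> {\<alpha>}" for y
        using that norm[OF g] R k(1) division_subringD[OF R(1)] by auto
      then show ?thesis
        using div_subring_gen_conjg[of g "K \<union> {\<alpha>}" x] M_nz[OF g] x unfolding R_def by blast
    qed
    then have "R - {0} \<subseteq> M \<or> R = UNIV \<or> R \<subseteq> center"
      using maxl R(1) by (intro maximal_subgroup_normalizes_division_subring)
    \<comment> \<open>If the units of \<open>R\<close> lay in \<open>M\<close>, then
      \<open>R\<close> would be commutative and \<open>\<alpha>\<close> would centralize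
      \<open>K\<close>, hence lie in \<open>K\<close>.\<close>
    then have R_UNIV: "R = UNIV"
    proof (elim disjE)
      assume "R - {0} \<subseteq> M"
      then have "\<alpha> \<in> K"
        using R \<alpha>(1) comm_if_units_subset[OF R(1)] by (intro K_self_centralizing) blast+
      then show ?thesis using False by blast
    next
      assume "R \<subseteq> center"
      then show ?thesis using R \<alpha> by blast
    qed
    define U where "U = (\<lambda>i. \<alpha> ^ i) ` {..<m}"
    show ?thesis
    proof (rule finite_dim_over_center_if_finite_normalizing_set[of K U])
      show "finite U" "0 \<notin> U"
        using \<alpha>_nz by (auto simp: U_def)
      show "1 \<in> U"
        using m by (auto simp: U_def intro!: image_eqI[of _ _ 0])
      \<comment> \<open>Division of the exponent by \<open>m\<close>: the power of
        \<open>\<alpha> ^ m\<close> is absorbed into \<open>K\<close>, and the remainder selects an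
        element of \<open>U\<close>.\<close>
      have decomp: "\<exists>w\<in>U. \<exists>k\<in>K. \<alpha> ^ i = k * w" for i
      proof (intro bexI)
        show "\<alpha> ^ i = (\<alpha> ^ m) ^ (i div m) * \<alpha> ^ (i mod m)"
          by (simp flip: power_mult power_add)
        show "(\<alpha> ^ m) ^ (i div m) \<in> K"
          by (rule division_subring_power[OF K m(2)])
        show "\<alpha> ^ (i mod m) \<in> U"
          using m by (auto simp: U_def)
      qed
      show "\<exists>w\<in>U. \<exists>k\<in>K. u * v = k * w" if "u \<in> U" "v \<in> U" for u v
        using that decomp by (auto simp: U_def simp flip: power_add)
      have "\<alpha> \<in> div_subring_gen (K \<union> U)"
        using decomp[of 1] subset_div_subring_gen[of "K \<union> U"]
          division_subringD(4)[OF division_subring_gen[of "K \<union> U"]] by auto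
      then have "R \<subseteq> div_subring_gen (K \<union> U)"
        unfolding R_def using subset_div_subring_gen[of "K \<union> U"]
        by (intro div_subring_gen_least division_subring_gen) auto
      then show "div_subring_gen (K \<union> U) = UNIV"
        using R_UNIV by blast
    qed (use K K_comm norm \<alpha>_pow in \<open>auto simp: U_def\<close>)
  qed
qed

end
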